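(* Let $\Gamma\cup\{A\}$ be a set of formulas. Then $\Gamma\vdash_{pml}A$ if and only if $\Gamma\vdash^{pml}A;$ (the latter with empty set after the semicolon).
   Context: Formulas. Let $\mathcal V_m$ (minimal variables), $\mathcal V_i$ (intuitionistic variables), $\mathcal V_c$ (classical variables) be three disjoint countable sets of propositional variables and $\perp$ a special constant. Formulas are built inductively from $\mathcal V_m\cup\mathcal V_i\cup\mathcal V_c\cup\{\perp\}$ using $\wedge,\vee,\to$; $\neg A$ abbreviates $A\to\perp$. $A$ is a classical formula if all its variables are in $\mathcal V_c$, and an intuitionistic formula if all its variables are in $\mathcal V_i\cup\mathcal V_c$. Natural deduction PML. Sequents are $\Gamma\vdash A$ with $\Gamma\cup\{A\}$ a finite set of formulas; commas denote union. Rules ($j\in\{1,2\}$): (Ax) $A\vdash A$; (W) from $\Gamma\vdash A$ infer $\Gamma,B\vdash A$; ($\wedge_I$) from $\Gamma_1\vdash A_1$ and $\Gamma_2\vdash A_2$ infer $\Gamma_1,\Gamma_2\vdash A_1\wedge A_2$; ($\wedge_E$) from $\Gamma\vdash A_1\wedge A_2$ infer $\Gamma\vdash A_j$; ($\vee_I$) from $\Gamma\vdash A_j$ infer $\Gamma\vdash A_1\vee A_2$; ($\vee_E$) from $\Gamma_1\vdash A_1\vee A_2$, $\Gamma_2,A_1\vdash B$ and $\Gamma_3,A_2\vdash B$ infer $\Gamma_1,\Gamma_2,\Gamma_3\vdash B$; ($\to_I$) from $\Gamma,A_1\vdash A_2$ infer $\Gamma\vdash A_1\to A_2$; ($\to_E$)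 from $\Gamma_1\vdash A_1\to A_2$ and $\Gamma_2\vdash A_1$ infer $\Gamma_1,\Gamma_2\vdash A_2$; ($\perp_i$) from $\Gamma\vdash\perp$ infer $\Gamma\vdash A$, provided $A$ is an intuitionistic formula; ($\perp_c$) from $\Gamma\vdash\neg\neg A$ infer $\Gamma\vdash A$, provided $A$ is a classical formula. $\Gamma\vdash_{pml}A$ means that $\Gamma\vdash A$ is derivable with these rules. PML sequent calculus. Sequents are $\Gamma\vdash'A;\Delta$ with $\Gamma$ a finite set of formulas, $\Delta$ a finite set of classical formulas, $A$ a formula. Rules ($j\in\{1,2\}$): (Ax) $A\vdash'A;$; (Cut) from $\Gamma_1,A\vdash'B;\Delta_1$ and $\Gamma_2\vdash'A;\Delta_2$ infer $\Gamma_1,\Gamma_2\vdash'B;\Delta_1,\Delta_2$; ($S_r$) from $\Gamma\vdash'A;\perp,\Delta$ infer $\Gamma\vdash'A;\Delta$; ($S_l$) from $\Gamma\vdash'A;A,\Delta$ infer $\Gamma\vdash'A;\Delta$; ($W_r$) from $\Gamma\vdash'\perp;\Delta$ infer $\Gamma\vdash'A;\Delta$, provided $A$ is an intuitionistic formula; ($W_l$) from $\Gamma\vdash'A;\Delta$ infer $\Gamma,B\vdash'A;\Delta$; ($W'_r$) from $\Gamma\vdash'A;\Delta$ infer $\Gamma\vdash'A;B,\Delta$, provided $B$ is a classical formula; ($E$) from $\Gamma\vdash'A;B,\Delta$ infer $\Gamma\vdash'B;A,\Delta$, provided $A$ is a classical formula; ($\wedge_r$) from $\Gamma_1\vdash'A_1;\Delta_1$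 and $\Gamma_2\vdash'A_2;\Delta_2$ infer $\Gamma_1,\Gamma_2\vdash'A_1\wedge A_2;\Delta_1,\Delta_2$; ($\wedge_l$) from $\Gamma,A_j\vdash'B;\Delta$ infer $\Gamma,A_1\wedge A_2\vdash'B;\Delta$; ($\vee_r$) from $\Gamma\vdash'A_j;\Delta$ infer $\Gamma\vdash'A_1\vee A_2;\Delta$; ($\vee_l$) from $\Gamma_1,A_1\vdash'B;\Delta_1$ and $\Gamma_2,A_2\vdash'B;\Delta_2$ infer $\Gamma_1,\Gamma_2,A_1\vee A_2\vdash'B;\Delta_1,\Delta_2$; ($\to_r$) from $\Gamma,A_1\vdash'A_2;\Delta$ infer $\Gamma\vdash'A_1\to A_2;\Delta$; ($\to_l$) from $\Gamma_1\vdash'A_1;\Delta_1$ and $\Gamma_2,A_2\vdash'B;\Delta_2$ infer $\Gamma_1,\Gamma_2,A_1\to A_2\vdash'B;\Delta_1,\Delta_2$. $\Gamma\vdash^{pml}A;\Delta$ means that $\Gamma\vdash'A;\Delta$ is derivable with these rules. For infinite $\Gamma$, both $\Gamma\vdash_{pml}A$ and $\Gamma\vdash^{pml}A;$ mean that the relation holds for some finite subset of $\Gamma$. *)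

theory Defs
  imports Main "HOL-Library.Countable"
begin

(* The three disjoint sets of variables are the ranges of the three constructors; the
   index types are arbitrary here and countable in the theorem. *)
datatype ('m, 'i, 'c) var = MVar 'm | IVar 'i | CVar 'c

datatype (vars: 'v) form =
    Var 'v
  | Bot ("\<^bold>\<bottom>")
  | And "'v form" "'v form" (infixr "\<^bold>\<and>" 67)
  | Or "'v form" "'v form" (infixr "\<^bold>\<or>" 66)
  | Imp "'v form" "'v form" (infixr "\<^bold>\<rightarrow>" 65)

abbreviation Neg :: "'v form \<Rightarrow> 'v form" ("\<^bold>\<not> _" [70] 70) where
  "\<^bold>\<not> A \<equiv> A \<^bold>\<rightarrow> \<^bold>\<bottom>"

type_synonym ('m, 'i, 'c) formula = "('m, 'i, 'c) var form"

definition classical :: "('m, 'i, 'c) formula \<Rightarrow> bool" where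
  "classical A \<longleftrightarrow> vars A \<subseteq> range CVar"

definition intuitionistic :: "('m, 'i, 'c) formula \<Rightarrow> bool" where
  "intuitionistic A \<longleftrightarrow> vars A \<subseteq> range IVar \<union> range CVar"

(* Finiteness of the contexts is not a premise of the rules: every derivable sequent has
   finite contexts, see nd_finite and sc_wf below. A context of the form insert A G may
   already have A in G, as in the set reading of "G, A". *)

inductive nd :: "('m, 'i, 'c) formula set \<Rightarrow> ('m, 'i, 'c) formula \<Rightarrow> bool" where
  Ax: "nd {A} A"
| W: "nd \<Gamma> A \<Longrightarrow> nd (insert B \<Gamma>) A"
| AndI: "nd \<Gamma>1 A1 \<Longrightarrow> nd \<Gamma>2 A2 \<Longrightarrow> nd (\<Gamma>1 \<union> \<Gamma>2) (A1 \<^bold>\<and> A2)"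
| AndE1: "nd \<Gamma> (A1 \<^bold>\<and> A2) \<Longrightarrow> nd \<Gamma> A1"
| AndE2: "nd \<Gamma> (A1 \<^bold>\<and> A2) \<Longrightarrow> nd \<Gamma> A2"
| OrI1: "nd \<Gamma> A1 \<Longrightarrow> nd \<Gamma> (A1 \<^bold>\<or> A2)"
| OrI2: "nd \<Gamma> A2 \<Longrightarrow> nd \<Gamma> (A1 \<^bold>\<or> A2)"
| OrE: "nd \<Gamma>1 (A1 \<^bold>\<or> A2) \<Longrightarrow> nd (insert A1 \<Gamma>2) B \<Longrightarrow> nd (insert A2 \<Gamma>3) B
    \<Longrightarrow> nd (\<Gamma>1 \<union> \<Gamma>2 \<union> \<Gamma>3) B"
| ImpI: "nd (insert A1 \<Gamma>) A2 \<Longrightarrow> nd \<Gamma> (A1 \<^bold>\<rightarrow> A2)"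
| ImpE: "nd \<Gamma>1 (A1 \<^bold>\<rightarrow> A2) \<Longrightarrow> nd \<Gamma>2 A1 \<Longrightarrow> nd (\<Gamma>1 \<union> \<Gamma>2) A2"
| BotI: "nd \<Gamma> \<^bold>\<bottom> \<Longrightarrow> intuitionistic A \<Longrightarrow> nd \<Gamma> A"
| BotC: "nd \<Gamma> (\<^bold>\<not> \<^bold>\<not> A) \<Longrightarrow> classical A \<Longrightarrow> nd \<Gamma> A"

inductive sc :: "('m, 'i, 'c) formula set \<Rightarrow> ('m, 'i, 'c) formula
    \<Rightarrow> ('m, 'i, 'c) formula set \<Rightarrow> bool" where
  Ax: "sc {A} A {}"
| Cut: "sc (insert A \<Gamma>1) B \<Delta>1 \<Longrightarrow> sc \<Gamma>2 A \<Delta>2 \<Longrightarrow> sc (\<Gamma>1 \<union> \<Gamma>2) B (\<Delta>1 \<union> \<Delta>2)"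
| Sr: "sc \<Gamma> A (insert \<^bold>\<bottom> \<Delta>) \<Longrightarrow> sc \<Gamma> A \<Delta>"
| Sl: "sc \<Gamma> A (insert A \<Delta>) \<Longrightarrow> sc \<Gamma> A \<Delta>"
| Wr: "sc \<Gamma> \<^bold>\<bottom> \<Delta> \<Longrightarrow> intuitionistic A \<Longrightarrow> sc \<Gamma> A \<Delta>"
| Wl: "sc \<Gamma> A \<Delta> \<Longrightarrow> sc (insert B \<Gamma>) A \<Delta>"
| Wr': "sc \<Gamma> A \<Delta> \<Longrightarrow> classical B \<Longrightarrow> sc \<Gamma> A (insert B \<Delta>)"
| E: "sc \<Gamma> A (insert B \<Delta>) \<Longrightarrow> classical A \<Longrightarrow> sc \<Gamma> B (insert A \<Delta>)"
| AndR: "sc \<Gamma>1 A1 \<Delta>1 \<Longrightarrow> sc \<Gamma>2 A2 \<Delta>2 \<Longrightarrow> sc (\<Gamma>1 \<union> \<Gamma>2) (A1 \<^bold>\<and> A2) (\<Delta>1 \<union> \<Delta>2)"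
| AndL1: "sc (insert A1 \<Gamma>) B \<Delta> \<Longrightarrow> sc (insert (A1 \<^bold>\<and> A2) \<Gamma>) B \<Delta>"
| AndL2: "sc (insert A2 \<Gamma>) B \<Delta> \<Longrightarrow> sc (insert (A1 \<^bold>\<and> A2) \<Gamma>) B \<Delta>"
| OrR1: "sc \<Gamma> A1 \<Delta> \<Longrightarrow> sc \<Gamma> (A1 \<^bold>\<or> A2) \<Delta>"
| OrR2: "sc \<Gamma> A2 \<Delta> \<Longrightarrow> sc \<Gamma> (A1 \<^bold>\<or> A2) \<Delta>"
| OrL: "sc (insert A1 \<Gamma>1) B \<Delta>1 \<Longrightarrow> sc (insert A2 \<Gamma>2) B \<Delta>2
    \<Longrightarrow> sc (insert (A1 \<^bold>\<or> A2) (\<Gamma>1 \<union> \<Gamma>2)) B (\<Delta>1 \<union> \<Delta>2)"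
| ImpR: "sc (insert A1 \<Gamma>) A2 \<Delta> \<Longrightarrow> sc \<Gamma> (A1 \<^bold>\<rightarrow> A2) \<Delta>"
| ImpL: "sc \<Gamma>1 A1 \<Delta>1 \<Longrightarrow> sc (insert A2 \<Gamma>2) B \<Delta>2
    \<Longrightarrow> sc (insert (A1 \<^bold>\<rightarrow> A2) (\<Gamma>1 \<union> \<Gamma>2)) B (\<Delta>1 \<union> \<Delta>2)"

lemma nd_finite: "nd \<Gamma> A \<Longrightarrow> finite \<Gamma>"
  by (induction rule: nd.induct) auto

lemma sc_wf: "sc \<Gamma> A \<Delta> \<Longrightarrow> finite \<Gamma> \<and> finite \<Delta> \<and> (\<forall>B\<in>\<Delta>. classical B)"
  by (induction rule: sc.induct) auto

definition nd_pml :: "('m, 'i, 'c) formula set \<Rightarrow> ('m, 'i, 'c) formula \<Rightarrow> bool" where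
  "nd_pml \<Gamma> A \<longleftrightarrow>
    (if finite \<Gamma> then nd \<Gamma> A else \<exists>\<Gamma>0. finite \<Gamma>0 \<and> \<Gamma>0 \<subseteq> \<Gamma> \<and> nd \<Gamma>0 A)"

definition sc_pml :: "('m, 'i, 'c) formula set \<Rightarrow> ('m, 'i, 'c) formula
    \<Rightarrow> ('m, 'i, 'c) formula set \<Rightarrow> bool" where
  "sc_pml \<Gamma> A \<Delta> \<longleftrightarrow>
    (if finite \<Gamma> then sc \<Gamma> A \<Delta> else \<exists>\<Gamma>0. finite \<Gamma>0 \<and> \<Gamma>0 \<subseteq> \<Gamma> \<and> sc \<Gamma>0 A \<Delta>)"

end

theory Submission
  imports Defs
begin

text \<open>
  The formulas to the right of the semicolon are stored alternatives to the succedent. As they are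
  all classical, each of them can be kept as a negated hypothesis instead and recovered with
  \<open>\<bottom>\<^sub>c\<close>. Hence a sequent \<open>\<Gamma> \<turnstile>' A; \<Delta>\<close> yields \<open>\<Gamma>, \<not>\<Delta> \<turnstile> A\<close> in natural deduction
  (lemma \<open>sc_imp_nd\<close>), although \<open>A\<close> itself may be minimal or intuitionistic. For empty \<open>\<Delta>\<close> this is
  one half of the equivalence.

  Conversely, a cut against a left rule simulates each elimination rule, and the double negation
  rule is the one place where the store is used (lemma \<open>sc_double_neg\<close>): exchanging the succedent
  with a stored \<open>\<bottom>\<close> gives \<open>A \<turnstile>' \<bottom>; A\<close>, therefore \<open>\<turnstile>' \<not>A; A\<close>, which refutes \<open>\<not>\<not>A\<close> with \<open>A\<close> kept in
  the store, from where \<open>S\<^sub>l\<close> retrieves it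
  once \<open>\<bottom>\<close> has been weakened to \<open>A\<close>.
\<close>

lemma classical_Bot: "classical \<^bold>\<bottom>"
  by (simp add: classical_def)

lemma classical_imp_intuitionistic: "classical A \<Longrightarrow> intuitionistic A"
  by (auto simp: classical_def intuitionistic_def)

lemma nd_cut:
  assumes "nd (insert A \<Gamma>1) B" and "nd \<Gamma>2 A"
  shows "nd (\<Gamma>1 \<union> \<Gamma>2) B"
  using nd.ImpE[OF nd.ImpI[OF assms(1)] assms(2)] .

lemma nd_classical_contradiction:
  assumes "nd (insert (\<^bold>\<not> A) \<Gamma>) \<^bold>\<bottom>" and "classical A"
  shows "nd \<Gamma> A"
  using nd.BotC[OF nd.ImpI[OF assms(1)] assms(2)] .

lemma nd_neg_elim:
  assumes "nd \<Gamma> A"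
  shows "nd (insert (\<^bold>\<not> A) \<Gamma>) \<^bold>\<bottom>"
  using nd.ImpE[OF nd.Ax assms, of \<open>\<^bold>\<bottom>\<close>] by simp

text \<open>
  The rules that touch the store become principles about negated hypotheses: \<open>S\<^sub>r\<close> discards the
  provable hypothesis \<open>\<not>\<bottom>\<close>, \<open>S\<^sub>l\<close> is the inference from \<open>\<not>A \<turnstile> A\<close> to \<open>A\<close>, and \<open>E\<close> is contraposition.
  The formulas recovered from their negations by \<open>S\<^sub>l\<close> and \<open>E\<close> come from the store and are therefore
  classical, as \<open>\<bottom>\<^sub>c\<close> requires.
\<close>

lemma sc_imp_nd: "sc \<Gamma> A \<Delta> \<Longrightarrow> nd (\<Gamma> \<union> Neg ` \<Delta>) A"
proof (induction rule: sc.induct)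
  case (Ax A)
  show ?case using nd.Ax by simp
next
  case (Cut A \<Gamma>1 B \<Delta>1 \<Gamma>2 \<Delta>2)
  have "nd ((\<Gamma>1 \<union> Neg ` \<Delta>1) \<union> (\<Gamma>2 \<union> Neg ` \<Delta>2)) B"
    using nd_cut[OF _ Cut.IH(2)] Cut.IH(1) by simp
  then show ?case by (simp add: image_Un Un_ac)
next
  case (Sr \<Gamma> A \<Delta>)
  have "nd {} (\<^bold>\<not> \<^bold>\<bottom>)" by (rule nd.ImpI[OF nd.Ax])
  then show ?case using nd_cut[of "\<^bold>\<not> \<^bold>\<bottom>" "\<Gamma> \<union> Neg ` \<Delta>" A "{}"] Sr.IH by simp
next
  case (Sl \<Gamma> A \<Delta>)
  have "nd (insert (\<^bold>\<not> A) (\<Gamma> \<union> Neg ` \<Delta>)) \<^bold>\<bottom>"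
    using nd_neg_elim[OF Sl.IH] by simp
  moreover have "classical A" using sc_wf[OF Sl.hyps] by blast
  ultimately show ?case by (rule nd_classical_contradiction)
next
  case (Wr \<Gamma> \<Delta> A)
  show ?case by (rule nd.BotI[OF Wr.IH Wr.hyps(2)])
next
  case (Wl \<Gamma> A \<Delta> B)
  show ?case using nd.W[OF Wl.IH] by simp
next
  case (Wr' \<Gamma> A \<Delta> B)
  show ?case using nd.W[OF Wr'.IH] by simp
next
  case (E \<Gamma> A B \<Delta>)
  have "nd (insert (\<^bold>\<not> B) (\<Gamma> \<union> Neg ` insert A \<Delta>)) \<^bold>\<bottom>"
    using nd_neg_elim[OF E.IH] by (simp add: insert_commute)
  moreover have "classical B" using sc_wf[OF E.hyps(1)] by blast
  ultimately show ?case by (rule nd_classical_contradiction)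
next
  case (AndR \<Gamma>1 A1 \<Delta>1 \<Gamma>2 A2 \<Delta>2)
  have "nd ((\<Gamma>1 \<union> Neg ` \<Delta>1) \<union> (\<Gamma>2 \<union> Neg ` \<Delta>2)) (A1 \<^bold>\<and> A2)"
    by (rule nd.AndI[OF AndR.IH])
  then show ?case by (simp add: image_Un Un_ac)
next
  case (AndL1 A1 \<Gamma> B \<Delta> A2)
  show ?case using nd_cut[OF _ nd.AndE1[OF nd.Ax]] AndL1.IH by fastforce
next
  case (AndL2 A2 \<Gamma> B \<Delta> A1)
  show ?case using nd_cut[OF _ nd.AndE2[OF nd.Ax]] AndL2.IH by fastforce
next
  case (OrR1 \<Gamma> A1 \<Delta> A2)
  show ?case by (rule nd.OrI1[OF OrR1.IH])
next
  case (OrR2 \<Gamma> A2 \<Delta> A1)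
  show ?case by (rule nd.OrI2[OF OrR2.IH])
next
  case (OrL A1 \<Gamma>1 B \<Delta>1 A2 \<Gamma>2 \<Delta>2)
  have "nd ({A1 \<^bold>\<or> A2} \<union> (\<Gamma>1 \<union> Neg ` \<Delta>1) \<union> (\<Gamma>2 \<union> Neg ` \<Delta>2)) B"
    using OrL.IH by (intro nd.OrE[OF nd.Ax]) (simp_all only: Un_insert_left)
  then show ?case by (simp add: image_Un Un_ac)
next
  case (ImpR A1 \<Gamma> A2 \<Delta>)
  then show ?case by (simp add: nd.ImpI)
next
  case (ImpL \<Gamma>1 A1 \<Delta>1 A2 \<Gamma>2 B \<Delta>2)
  have "nd ((\<Gamma>2 \<union> Neg ` \<Delta>2) \<union> ({A1 \<^bold>\<rightarrow> A2} \<union> (\<Gamma>1 \<union> Neg ` \<Delta>1))) B"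
    using nd_cut[OF _ nd.ImpE[OF nd.Ax ImpL.IH(1)]] ImpL.IH(2) by simp
  then show ?case by (simp add: image_Un Un_ac)
qed

text \<open>
  With a left rule applied to axioms as the first premise, this is an elimination rule.
\<close>

lemma sc_apply:
  assumes "sc {A} B \<Delta>" and "sc \<Gamma> A {}"
  shows "sc \<Gamma> B \<Delta>"
  using sc.Cut[OF assms] by simp

lemma sc_double_neg:
  assumes "sc \<Gamma> (\<^bold>\<not> \<^bold>\<not> A) {}" and "classical A"
  shows "sc \<Gamma> A {}"
proof -
  have "sc {A} A {\<^bold>\<bottom>}" using sc.Wr'[OF sc.Ax classical_Bot] .
  then have "sc {A} \<^bold>\<bottom> {A}" using assms(2) by (rule sc.E)
  then have "sc {} (\<^bold>\<not> A) {A}" by (rule sc.ImpR)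
  then have "sc {\<^bold>\<not> \<^bold>\<not> A} \<^bold>\<bottom> {A}" using sc.ImpL[OF _ sc.Ax, of "{}" _ _ "\<^bold>\<bottom>"] by simp
  then have "sc \<Gamma> \<^bold>\<bottom> {A}" using assms(1) by (rule sc_apply)
  then have "sc \<Gamma> A {A}" using classical_imp_intuitionistic[OF assms(2)] by (rule sc.Wr)
  then show ?thesis by (rule sc.Sl)
qed

lemma nd_imp_sc: "nd \<Gamma> A \<Longrightarrow> sc \<Gamma> A {}"
proof (induction rule: nd.induct)
  case (Ax A)
  show ?case by (rule sc.Ax)
next
  case (W \<Gamma> A B)
  show ?case by (rule sc.Wl[OF W.IH])
next
  case (AndI \<Gamma>1 A1 \<Gamma>2 A2)
  show ?case using sc.AndR[OF AndI.IH] by simp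
next
  case (AndE1 \<Gamma> A1 A2)
  show ?case by (rule sc_apply[OF sc.AndL1[OF sc.Ax] AndE1.IH])
next
  case (AndE2 \<Gamma> A1 A2)
  show ?case by (rule sc_apply[OF sc.AndL2[OF sc.Ax] AndE2.IH])
next
  case (OrI1 \<Gamma> A1 A2)
  show ?case by (rule sc.OrR1[OF OrI1.IH])
next
  case (OrI2 \<Gamma> A2 A1)
  show ?case by (rule sc.OrR2[OF OrI2.IH])
next
  case (OrE \<Gamma>1 A1 A2 \<Gamma>2 B \<Gamma>3)
  show ?case using sc.Cut[OF sc.OrL[OF OrE.IH(2,3)] OrE.IH(1)] by (simp add: Un_ac)
next
  case (ImpI A1 \<Gamma> A2)
  show ?case by (rule sc.ImpR[OF ImpI.IH])
next
  case (ImpE \<Gamma>1 A1 A2 \<Gamma>2)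
  have "sc (insert (A1 \<^bold>\<rightarrow> A2) \<Gamma>2) A2 {}"
    using sc.ImpL[OF ImpE.IH(2) sc.Ax] by simp
  from sc.Cut[OF this ImpE.IH(1)] show ?case by (simp add: Un_ac)
next
  case (BotI \<Gamma> A)
  show ?case by (rule sc.Wr[OF BotI.IH BotI.hyps(2)])
next
  case (BotC \<Gamma> A)
  show ?case by (rule sc_double_neg[OF BotC.IH BotC.hyps(2)])
qed

lemma nd_iff_sc: "nd \<Gamma> A \<longleftrightarrow> sc \<Gamma> A {}"
  using nd_imp_sc sc_imp_nd[of \<Gamma> A "{}"] by auto

theorem corollary59:
  fixes \<Gamma> :: "('m::countable, 'i::countable, 'c::countable) formula set"
    and A :: "('m, 'i, 'c) formula"
  shows "nd_pml \<Gamma> A \<longleftrightarrow> sc_pml \<Gamma> A {}"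
  by (simp add: nd_pml_def sc_pml_def nd_iff_sc)

end
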